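(* Let the sequence $\{x^t\}$ be generated by algorithm AEPG (described in the context) under the standing assumptions. There is a positive constant $\overline{\mathrm v}$ (independent of $t$ and $T$) with $\mathcal V_t\le\overline{\mathrm v}$ for all $t\ge 0$, and for this constant, for every integer $T\ge 0$ (resp. $T\geq 1$ in (b)): (a) $\sum_{t=0}^T\|x^{t+1}-x^t\|_2^2\le \overline{\mathrm X}\triangleq \frac1\alpha\big((\overline{\mathrm v}/\underline{\mathrm v})^2-1\big)$. (b) $\frac1{T+1}\sum_{t=0}^T \|\nabla f(x^{t+1})+\partial h(x^{t+1})\| = \mathcal O(1/\sqrt T)$, where the hidden constant does not depend on $T$. In other words, there is a constant $C>0$ independent of $\epsilon$ and $T$ such that for every $\epsilon>0$, if $T\ge C/\epsilon^2$ then there exists $\bar t\in\{1,\dots,T\}$ with $\|\nabla f(x^{\bar t})+\partial h(x^{\bar t})\|\le\epsilon$.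
   Context: Problem: minimize $F(x)=f(x)+h(x)$ over $x\in\mathbb R^n$, where $f=\frac1N\sum_{i=1}^N f_i$, each $f_i:\mathbb R^n\to\mathbb R$ is differentiable (possibly nonconvex), and $h:\mathbb R^n\to(-\infty,+\infty]$ is proper and lower semicontinuous (possibly nonconvex, nonsmooth). Notation: vector operations ($\odot$ product, $\div$ division, square root) and inequalities are componentwise; $\mathbf 1$ is the all-ones vector; $\min(v),\max(v)$ are the smallest and largest entries of a vector $v$; $\|x\|=\|x\|_2$; $\|x\|_v^2=\sum_i x_i^2v_i$ for $v\ge 0$; $\partial h$ is the limiting subdifferential, and $\|\nabla f(x)+\partial h(x)\|$ denotes $\inf\{\|\nabla f(x)+\xi\|:\xi\in\partial h(x)\}$. Standing assumptions: (1) the generalized proximal operator $\mathrm{Prox}_h(a;v)\triangleq\arg\min_x h(x)+\frac12\|x-a\|_v^2$ is nonempty (can be computed exactly) for all $a\in\mathbb R^n$ and all $v\in\mathbb R^n$ with positive entries; (2) there is $\overline{\mathrm x}>0$ with $\|x\|\le\overline{\mathrm x}$ for all $x\in\mathrm{dom}(F)$, and $\min_xF(x)>-\infty$; (3) each $f_j$ is $L$-smooth: $\|\nabla f_j(x)-\nabla f_j(\tilde x)\|\le L\|x-\tilde x\|$ for all $x,\tilde x$. Algorithm AEPG: parameters $\underline{\mathrm v}>0$, $\alpha>0$, $\beta\ge0$, $\theta\in[0,1)$; initial point $x^0\in\mathrm{dom}(F)$, $x^{-1}=x^0$, $v^0=\underline{\mathrm v}\mathbf 1$, $y^0=x^0$,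 $\sigma^{-1}=\theta$. For $t=0,1,2,\dots$: $g^t=\nabla f(y^t)$; $x^{t+1}\in\mathrm{Prox}_h(y^t-g^t\div v^t;v^t)$; $d^t=x^{t+1}-x^t$; $r^t=v^t\odot d^t$; $s^t=\alpha\|r^t\|_2^2\mathbf 1+\beta\, r^t\odot r^t$; $v^{t+1}=\sqrt{v^0\odot v^0+\sum_{i=0}^t s^i}$; $\sigma^t=\theta(1-\sigma^{t-1})\min(v^t\div v^{t+1})$; $y^{t+1}=x^{t+1}+\sigma^t d^t$. Define $\mathcal R_t=\sum_{i=0}^t\|r^i\|_2^2$, $\mathcal V_{t+1}=\sqrt{\underline{\mathrm v}^2+(\alpha+\beta)\mathcal R_t}$ for $t\ge0$, and $\mathcal V_0=\underline{\mathrm v}$. *)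

theory Defs
  imports "HOL-Analysis.Analysis"
begin

definition gradient :: "('a::real_inner \<Rightarrow> real) \<Rightarrow> 'a \<Rightarrow> 'a" where
  "gradient f x = (THE D. GDERIV f x :> D)"

definition average :: "nat \<Rightarrow> (nat \<Rightarrow> 'a \<Rightarrow> real) \<Rightarrow> 'a \<Rightarrow> real" where
  "average N f x = (1 / real N) * (\<Sum>j=1..N. f j x)"

definition objective :: "('a \<Rightarrow> real) \<Rightarrow> ('a \<Rightarrow> ereal) \<Rightarrow> 'a \<Rightarrow> ereal" where
  "objective f h x = ereal (f x) + h x"

definition edom :: "('a \<Rightarrow> ereal) \<Rightarrow> 'a set" where
  "edom \<phi> = {x. \<phi> x < \<infinity>}"

definition proper :: "('a \<Rightarrow> ereal) \<Rightarrow> bool" where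
  "proper \<phi> \<longleftrightarrow> (\<forall>x. \<phi> x \<noteq> -\<infinity>) \<and> edom \<phi> \<noteq> {}"

definition lower_semicontinuous :: "('a::topological_space \<Rightarrow> ereal) \<Rightarrow> bool" where
  "lower_semicontinuous \<phi> \<longleftrightarrow> (\<forall>x. \<phi> x \<le> Liminf (at x) \<phi>)"

definition frechet_subdiff :: "('a::real_inner \<Rightarrow> ereal) \<Rightarrow> 'a \<Rightarrow> 'a set" where
  "frechet_subdiff \<phi> x = {\<xi>. \<bar>\<phi> x\<bar> \<noteq> \<infinity> \<and>
     0 \<le> Liminf (at x) (\<lambda>z. (\<phi> z - \<phi> x - ereal (\<xi> \<bullet> (z - x))) / ereal (norm (z - x)))}"

definition limiting_subdiff :: "('a::real_inner \<Rightarrow> ereal) \<Rightarrow> 'a \<Rightarrow> 'a set" where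
  "limiting_subdiff \<phi> x = {\<xi>. \<bar>\<phi> x\<bar> \<noteq> \<infinity> \<and>
     (\<exists>u \<eta>. u \<longlonglongrightarrow> x \<and> (\<lambda>k. \<phi> (u k)) \<longlonglongrightarrow> \<phi> x \<and>
            (\<forall>k. \<eta> k \<in> frechet_subdiff \<phi> (u k)) \<and> \<eta> \<longlonglongrightarrow> \<xi>)}"

text \<open>Extended-real valued, so that the infimum over an empty subdifferential is
  \<open>\<infinity>\<close> rather than an unspecified real number.\<close>

definition stationarity :: "('a::real_inner \<Rightarrow> real) \<Rightarrow> ('a \<Rightarrow> ereal) \<Rightarrow> 'a \<Rightarrow> ereal" where
  "stationarity f h x = (INF \<xi>\<in>limiting_subdiff h x. ereal (norm (gradient f x + \<xi>)))"

text \<open>On \<open>real ^ 'n\<close> the library multiplication \<open>*\<close> is componentwise and \<open>1\<close> is the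
  all-ones vector; componentwise division and square root are not provided.\<close>

definition vec_div :: "real ^ 'n \<Rightarrow> real ^ 'n \<Rightarrow> real ^ 'n" where
  "vec_div u w = (\<chi> i. u $ i / w $ i)"

definition vec_sqrt :: "real ^ 'n \<Rightarrow> real ^ 'n" where
  "vec_sqrt u = (\<chi> i. sqrt (u $ i))"

definition min_entry :: "real ^ 'n \<Rightarrow> real" where
  "min_entry u = (MIN i. u $ i)"

definition weighted_norm_sq :: "real ^ 'n \<Rightarrow> real ^ 'n \<Rightarrow> real" where
  "weighted_norm_sq v x = (\<Sum>i\<in>UNIV. (x $ i)\<^sup>2 * v $ i)"

definition Prox :: "(real ^ 'n \<Rightarrow> ereal) \<Rightarrow> real ^ 'n \<Rightarrow> real ^ 'n \<Rightarrow> (real ^ 'n) set" where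
  "Prox h a v =
     {x. is_arg_min (\<lambda>u. h u + ereal (1 / 2 * weighted_norm_sq v (u - a))) (\<lambda>_. True) x}"

text \<open>The convention \<open>\<sigma>\<^sup>-\<^sup>1 = \<theta>\<close> is the \<open>t = 0\<close> branch of the recursion for \<open>\<sigma>\<close>; the
  point \<open>x\<^sup>-\<^sup>1\<close> never enters the iteration.\<close>

definition AEPG ::
  "(real ^ 'n \<Rightarrow> real) \<Rightarrow> (real ^ 'n \<Rightarrow> ereal) \<Rightarrow> real \<Rightarrow> real \<Rightarrow> real \<Rightarrow> real \<Rightarrow>
   (nat \<Rightarrow> real ^ 'n) \<Rightarrow> (nat \<Rightarrow> real ^ 'n) \<Rightarrow> (nat \<Rightarrow> real ^ 'n) \<Rightarrow> (nat \<Rightarrow> real ^ 'n) \<Rightarrow>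
   (nat \<Rightarrow> real ^ 'n) \<Rightarrow> (nat \<Rightarrow> real ^ 'n) \<Rightarrow> (nat \<Rightarrow> real ^ 'n) \<Rightarrow> (nat \<Rightarrow> real) \<Rightarrow> bool" where
  "AEPG f h vlow \<alpha> \<beta> \<theta> x y g d r s v \<sigma> \<longleftrightarrow>
     x 0 \<in> edom (objective f h) \<and> v 0 = vlow *\<^sub>R 1 \<and> y 0 = x 0 \<and>
     (\<forall>t. g t = gradient f (y t) \<and>
          x (Suc t) \<in> Prox h (y t - vec_div (g t) (v t)) (v t) \<and>
          d t = x (Suc t) - x t \<and>
          r t = v t * d t \<and>
          s t = (\<alpha> * (norm (r t))\<^sup>2) *\<^sub>R 1 + \<beta> *\<^sub>R (r t * r t) \<and>
          v (Suc t) = vec_sqrt (v 0 * v 0 + (\<Sum>i\<le>t. s i)) \<and>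
          \<sigma> t = \<theta> * (1 - (if t = 0 then \<theta> else \<sigma> (t - 1))) * min_entry (vec_div (v t) (v (Suc t))) \<and>
          y (Suc t) = x (Suc t) + \<sigma> t *\<^sub>R d t)"

definition cal_R :: "(nat \<Rightarrow> real ^ 'n) \<Rightarrow> nat \<Rightarrow> real" where
  "cal_R r t = (\<Sum>i\<le>t. (norm (r i))\<^sup>2)"

fun cal_V :: "real \<Rightarrow> real \<Rightarrow> real \<Rightarrow> (nat \<Rightarrow> real ^ 'n) \<Rightarrow> nat \<Rightarrow> real" where
  "cal_V vlow \<alpha> \<beta> r 0 = vlow"
| "cal_V vlow \<alpha> \<beta> r (Suc t) = sqrt (vlow\<^sup>2 + (\<alpha> + \<beta>) * cal_R r t)"

end

theory Submission
  imports Defs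
begin

text \<open>Comparing \<open>x\<^sup>t\<^sup>+\<^sup>1\<close> with \<open>x\<^sup>t\<close> in the proximal step, the choice of \<open>\<sigma>\<close> makes the momentum
  cross term cost at most \<open>\<theta>\<close> times the energy of the previous step, so that
  \<open>F\<close> plus previous energies changes by at most \<open>- (1 - \<theta>) E\<^sub>t + 2 L \<parallel>d\<^sup>t\<parallel>\<^sup>2\<close>.
  If the sum of the \<open>\<parallel>r\<^sup>t\<parallel>\<^sup>2\<close> is unbounded, then because \<open>\<alpha> > 0\<close> every entry of \<open>v\<^sup>t\<close>
  eventually exceeds a multiple of \<open>L\<close>, after which the error is absorbed into the energy and the
  potential decreases by at least a multiple of \<open>V\<^sub>t\<^sub>+\<^sub>1 - V\<^sub>t\<close>; as it is bounded below, \<open>V\<close> is bounded.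
  Then the \<open>\<parallel>d\<^sup>t\<parallel>\<^sup>2\<close> are summable, and the optimality condition of the proximal step bounds the
  stationarity measure by a multiple of \<open>\<parallel>d\<^sup>t\<parallel> + \<parallel>d\<^sup>t\<^sup>-\<^sup>1\<parallel>\<close>.\<close>

section \<open>Gradients\<close>

lemma gradient_eqI:
  assumes "GDERIV f x :> D"
  shows "gradient f x = D"
  unfolding gradient_def
proof (rule the_equality)
  show "GDERIV f x :> D" by (rule assms)
next
  fix D' assume "GDERIV f x :> D'"
  with assms have "(\<lambda>u. u \<bullet> D') = (\<lambda>u. u \<bullet> D)"
    unfolding gderiv_def by (rule has_derivative_unique[rotated])
  then have "(D' - D) \<bullet> D' = (D' - D) \<bullet> D" by meson
  then have "(D' - D) \<bullet> (D' - D) = 0" by (simp only: inner_diff_right)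
  then show "D' = D" by simp
qed

text \<open>Riesz representation in finite dimension: the derivative is linear, so its values on the
  basis are the coordinates of the representing vector.\<close>

lemma GDERIV_gradient:
  fixes f :: "'a::euclidean_space \<Rightarrow> real"
  assumes "f differentiable (at x)"
  shows "GDERIV f x :> gradient f x"
proof -
  obtain f' where f': "(f has_derivative f') (at x)"
    using assms unfolding differentiable_def by blast
  then interpret linear f' by (rule has_derivative_linear)
  define D where "D = (\<Sum>b\<in>Basis. f' b *\<^sub>R b)"
  have "f' u = u \<bullet> D" for u
  proof -
    have "f' u = f' (\<Sum>b\<in>Basis. (u \<bullet> b) *\<^sub>R b)" by (simp add: euclidean_representation)
    also have "\<dots> = u \<bullet> D" by (simp add: sum scale D_def inner_sum_right mult.commute)
    finally show ?thesis .
  qed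
  then have "f' = (\<lambda>u. u \<bullet> D)" by (rule ext)
  with f' have "GDERIV f x :> D" by (simp add: gderiv_def)
  then show ?thesis using gradient_eqI by metis
qed

lemma GDERIV_average:
  assumes "\<And>j. j \<in> {1..N} \<Longrightarrow> GDERIV (f j) u :> D j"
  shows "GDERIV (average N f) u :> (1 / real N) *\<^sub>R (\<Sum>j=1..N. D j)"
proof -
  have "(average N f has_derivative (\<lambda>z. (1 / real N) * (\<Sum>j=1..N. z \<bullet> D j))) (at u)"
    unfolding average_def[abs_def]
    using assms by (intro has_derivative_mult_right has_derivative_sum) (auto simp: gderiv_def)
  then show ?thesis
    by (simp add: gderiv_def inner_sum_right)
qed

lemma gradient_average_lipschitz:
  fixes f :: "nat \<Rightarrow> 'a::euclidean_space \<Rightarrow> real"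
  assumes "N \<ge> 1"
    and "\<And>j u. j \<in> {1..N} \<Longrightarrow> f j differentiable (at u)"
    and "\<And>j. j \<in> {1..N} \<Longrightarrow> norm (gradient (f j) u - gradient (f j) w) \<le> B"
  shows "norm (gradient (average N f) u - gradient (average N f) w) \<le> B"
proof -
  have grad: "gradient (average N f) z = (1 / real N) *\<^sub>R (\<Sum>j=1..N. gradient (f j) z)" for z
    using assms(2) by (intro gradient_eqI GDERIV_average GDERIV_gradient)
  have "norm (\<Sum>j=1..N. gradient (f j) u - gradient (f j) w) \<le> (\<Sum>j=1..N. B)"
    using assms(3) by (intro sum_norm_le) auto
  then have "norm (\<Sum>j=1..N. gradient (f j) u - gradient (f j) w) \<le> real N * B" by simp
  moreover have "gradient (average N f) u - gradient (average N f) w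
      = (1 / real N) *\<^sub>R (\<Sum>j=1..N. gradient (f j) u - gradient (f j) w)"
    by (simp add: grad sum_subtractf scaleR_diff_right)
  ultimately show ?thesis
    using assms(1) by (simp add: field_simps)
qed

text \<open>The one-variable mean value theorem on the segment from \<open>a\<close> to
  \<open>b\<close>. Only the distance of \<open>z\<close> to \<open>a\<close> is recorded, which is
  what a Lipschitz bound on the gradient consumes.\<close>

lemma GDERIV_mean_value:
  fixes f :: "'a::real_inner \<Rightarrow> real"
  assumes "\<And>u. GDERIV f u :> G u"
  obtains z where "f b - f a = G z \<bullet> (b - a)" "norm (z - a) \<le> norm (b - a)"
proof -
  let ?p = "\<lambda>s. a + s *\<^sub>R (b - a)"
  have "((\<lambda>s. f (?p s)) has_derivative (\<lambda>k. (k *\<^sub>R (b - a)) \<bullet> G (?p s))) (at s within {0..1})" for s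
  proof -
    have "((?p) has_derivative (\<lambda>k. k *\<^sub>R (b - a))) (at s within {0..1})"
      by (auto intro!: derivative_eq_intros)
    moreover have "(f has_derivative (\<lambda>u. u \<bullet> G (?p s))) (at (?p s))"
      using assms by (simp add: gderiv_def)
    ultimately show ?thesis
      by (rule has_derivative_compose)
  qed
  then obtain s where s: "s \<in> {0..1}"
    "f (?p 1) - f (?p 0) = ((1 - 0) *\<^sub>R (b - a)) \<bullet> G (?p s)"
    using mvt_very_simple[of 0 1 "\<lambda>s. f (?p s)" "\<lambda>s k. (k *\<^sub>R (b - a)) \<bullet> G (?p s)"] by auto
  show thesis
  proof (rule that)
    show "f b - f a = G (?p s) \<bullet> (b - a)" using s(2) by (simp add: inner_commute)
    show "norm (?p s - a) \<le> norm (b - a)" using s(1) by (simp add: mult_left_le_one_le)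
  qed
qed

section \<open>Weighted norms\<close>

lemma norm_sq_vec: "(norm (u :: real ^ 'n))\<^sup>2 = (\<Sum>i\<in>UNIV. (u $ i)\<^sup>2)"
  by (simp add: norm_vec_def L2_set_def sum_nonneg)

lemma weighted_norm_sq_nonneg:
  assumes "\<And>i. 0 \<le> w $ i"
  shows "0 \<le> weighted_norm_sq w u"
  unfolding weighted_norm_sq_def using assms by (intro sum_nonneg) auto

lemma weighted_norm_sq_le:
  assumes "\<And>i. w $ i \<le> B"
  shows "weighted_norm_sq w u \<le> B * (norm u)\<^sup>2"
  unfolding weighted_norm_sq_def norm_sq_vec sum_distrib_left
  by (intro sum_mono) (simp add: assms mult.commute[of _ "w $ _"] mult_right_mono)

lemma weighted_norm_sq_ge:
  assumes "\<And>i. b \<le> w $ i"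
  shows "b * (norm u)\<^sup>2 \<le> weighted_norm_sq w u"
  unfolding weighted_norm_sq_def norm_sq_vec sum_distrib_left
  by (intro sum_mono) (simp add: assms mult.commute[of _ "w $ _"] mult_right_mono)

text \<open>Exact second-order expansion around \<open>u\<close>. It yields both the optimality
  condition and the descent inequality of the proximal step.\<close>

lemma weighted_norm_sq_diff:
  "weighted_norm_sq w (z - a)
     = weighted_norm_sq w (u - a) + 2 * ((w * (u - a)) \<bullet> (z - u)) + weighted_norm_sq w (z - u)"
  unfolding weighted_norm_sq_def inner_vec_def sum_distrib_left sum.distrib[symmetric]
  by (intro sum.cong) (auto simp: power2_eq_square algebra_simps)

text \<open>Only one of the two factors \<open>w $ i\<close> is replaced by \<open>B\<close>; the
  other stays as the weight. This later bounds the growth of \<open>V\<close> by the energy.\<close>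

lemma norm_mult_sq_le_weighted:
  assumes "\<And>i. 0 \<le> w $ i" "\<And>i. w $ i \<le> B"
  shows "(norm (w * u))\<^sup>2 \<le> B * weighted_norm_sq w u"
  unfolding weighted_norm_sq_def norm_sq_vec sum_distrib_left
proof (intro sum_mono)
  fix i
  have "(w $ i * (u $ i)\<^sup>2) * w $ i \<le> (w $ i * (u $ i)\<^sup>2) * B"
    using assms by (intro mult_left_mono) auto
  then show "((w * u) $ i)\<^sup>2 \<le> B * ((u $ i)\<^sup>2 * w $ i)"
    by (simp add: power2_eq_square mult_ac)
qed

lemma norm_mult_le:
  fixes w u :: "real ^ 'n"
  assumes "\<And>i. 0 \<le> w $ i" "\<And>i. w $ i \<le> B"
  shows "norm (w * u) \<le> B * norm u"
proof (rule power2_le_imp_le)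
  have "0 \<le> B" using assms order_trans by blast
  then show "0 \<le> B * norm u" by simp
  have "(norm (w * u))\<^sup>2 \<le> B * (B * (norm u)\<^sup>2)"
    using norm_mult_sq_le_weighted[OF assms] weighted_norm_sq_le[OF assms(2), of u] \<open>0 \<le> B\<close>
    by (meson mult_left_mono order_trans)
  then show "(norm (w * u))\<^sup>2 \<le> (B * norm u)\<^sup>2" by (simp add: power2_eq_square mult_ac)
qed

lemma norm_mult_sq_ge:
  fixes w u :: "real ^ 'n"
  assumes "0 \<le> b" "\<And>i. b \<le> w $ i"
  shows "b\<^sup>2 * (norm u)\<^sup>2 \<le> (norm (w * u))\<^sup>2"
  unfolding norm_sq_vec sum_distrib_left
proof (intro sum_mono)
  fix i
  have "b\<^sup>2 \<le> (w $ i)\<^sup>2" using assms by (intro power_mono) auto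
  then have "b\<^sup>2 * (u $ i)\<^sup>2 \<le> (w $ i)\<^sup>2 * (u $ i)\<^sup>2" by (intro mult_right_mono) auto
  then show "b\<^sup>2 * (u $ i)\<^sup>2 \<le> ((w * u) $ i)\<^sup>2" by (simp add: power_mult_distrib)
qed

lemma inner_weighted_young:
  fixes w u z :: "real ^ 'n"
  assumes "\<And>i. 0 \<le> w $ i"
  shows "2 * ((w * u) \<bullet> z) \<le> weighted_norm_sq w u + weighted_norm_sq w z"
  unfolding weighted_norm_sq_def inner_vec_def sum_distrib_left sum.distrib[symmetric]
proof (intro sum_mono)
  fix i
  have "0 \<le> w $ i * (u $ i - z $ i)\<^sup>2" using assms by simp
  then show "2 * ((w * u) $ i \<bullet> z $ i) \<le> (u $ i)\<^sup>2 * w $ i + (z $ i)\<^sup>2 * w $ i"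
    by (simp add: power2_eq_square algebra_simps)
qed

section \<open>The proximal step\<close>

lemma Prox_le:
  assumes "x \<in> Prox h a w"
  shows "h x + ereal (1/2 * weighted_norm_sq w (x - a)) \<le> h u + ereal (1/2 * weighted_norm_sq w (u - a))"
  using assms unfolding Prox_def is_arg_min_def by (auto simp: not_less)

lemma Prox_finite:
  assumes "x \<in> Prox h a w" "proper h"
  shows "\<bar>h x\<bar> \<noteq> \<infinity>"
proof -
  obtain u where "h u < \<infinity>" "h u \<noteq> -\<infinity>" "h x \<noteq> -\<infinity>"
    using assms(2) unfolding proper_def edom_def by blast
  then show ?thesis
    using Prox_le[OF assms(1), of u] by (cases "h x"; cases "h u") auto
qed

lemma frechet_subset_limiting: "frechet_subdiff h x \<subseteq> limiting_subdiff h x"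
proof
  fix \<xi> assume xi: "\<xi> \<in> frechet_subdiff h x"
  then have "\<bar>h x\<bar> \<noteq> \<infinity>" by (simp add: frechet_subdiff_def)
  moreover have "(\<lambda>k::nat. x) \<longlonglongrightarrow> x" "(\<lambda>k::nat. h x) \<longlonglongrightarrow> h x" "(\<lambda>k::nat. \<xi>) \<longlonglongrightarrow> \<xi>" by simp_all
  ultimately show "\<xi> \<in> limiting_subdiff h x"
    unfolding limiting_subdiff_def using xi
    by (intro CollectI conjI exI[of _ "\<lambda>_. x"] exI[of _ "\<lambda>_. \<xi>"]) auto
qed

text \<open>Minimality gives a lower bound on \<open>h\<close> that is linear with slope
  \<open>- (w * (x - a))\<close> up to a quadratic error, and this error is negligible against
  \<open>norm (z - x)\<close>.\<close>

lemma Prox_subgradient: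
  assumes x: "x \<in> Prox h a w" and "proper h"
  shows "- (w * (x - a)) \<in> frechet_subdiff h x"
proof -
  let ?\<xi> = "- (w * (x - a))"
  define B where "B = Max (range (($) w))"
  have B: "w $ i \<le> B" for i by (simp add: B_def)
  obtain c where c: "h x = ereal c" using Prox_finite[OF assms] by (cases "h x") auto
  have quot: "ereal (- (B/2) * norm (z - x)) \<le> (h z - h x - ereal (?\<xi> \<bullet> (z - x))) / ereal (norm (z - x))"
    if "z \<noteq> x" for z
  proof -
    have pos: "norm (z - x) > 0" using that by simp
    have "h z \<noteq> -\<infinity>" using assms(2) by (simp add: proper_def)
    then consider k where "h z = ereal k" | "h z = \<infinity>" by (cases "h z") auto
    then show ?thesis
    proof cases
      case 1
      have "- (B/2) * (norm (z - x))\<^sup>2 \<le> k - c - ?\<xi> \<bullet> (z - x)"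
        using Prox_le[OF x, of z] weighted_norm_sq_diff[of w z a x] weighted_norm_sq_le[OF B, of "z - x"]
        by (simp add: c 1 add_divide_distrib)
      then have "- (B/2) * norm (z - x) \<le> (k - c - ?\<xi> \<bullet> (z - x)) / norm (z - x)"
        using pos by (simp add: pos_le_divide_eq power2_eq_square)
      then show ?thesis using that by (simp add: c 1)
    next
      case 2
      then show ?thesis using pos by (simp add: c)
    qed
  qed
  have "((\<lambda>z. ereal (- (B/2) * norm (z - x))) \<longlongrightarrow> ereal (- (B/2) * norm (x - x))) (at x)"
    by (intro tendsto_intros)
  then have "Liminf (at x) (\<lambda>z. ereal (- (B/2) * norm (z - x))) = ereal (- (B/2) * norm (x - x))"
    by (intro lim_imp_Liminf) simp_all
  then have "0 = Liminf (at x) (\<lambda>z. ereal (- (B/2) * norm (z - x)))" by simp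
  also have "\<dots> \<le> Liminf (at x) (\<lambda>z. (h z - h x - ereal (?\<xi> \<bullet> (z - x))) / ereal (norm (z - x)))"
    using quot by (intro Liminf_mono) (auto simp: eventually_at_filter)
  finally show ?thesis
    using c by (simp add: frechet_subdiff_def)
qed


section \<open>The algorithm\<close>

locale aepg_run =
  fixes f :: "real ^ 'n \<Rightarrow> real"
    and h :: "real ^ 'n \<Rightarrow> ereal"
    and L m vlow \<alpha> \<beta> \<theta> :: real
    and x y g d r s v :: "nat \<Rightarrow> real ^ 'n"
    and \<sigma> :: "nat \<Rightarrow> real"
  assumes gderiv: "GDERIV f u :> gradient f u"
    and lipschitz: "norm (gradient f u - gradient f w) \<le> L * norm (u - w)"
    and proper: "proper h"
    and objective_ge: "ereal m \<le> objective f h u"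
    and vlow_pos: "vlow > 0" and alpha_pos: "\<alpha> > 0" and beta_nonneg: "\<beta> \<ge> 0"
    and theta_nonneg: "0 \<le> \<theta>" and theta_less_1: "\<theta> < 1"
    and run: "AEPG f h vlow \<alpha> \<beta> \<theta> x y g d r s v \<sigma>"
begin

abbreviation V :: "nat \<Rightarrow> real" where "V \<equiv> cal_V vlow \<alpha> \<beta> r"

text \<open>The coefficient with index \<open>t - 1\<close>, so that the initial convention becomes
  an ordinary value at 0.\<close>

definition \<tau> :: "nat \<Rightarrow> real" where
  "\<tau> t = (if t = 0 then \<theta> else \<sigma> (t - 1))"

text \<open>The value 0 at the start reflects \<open>y 0 = x 0\<close>: there is no earlier step to
  carry momentum.\<close>

definition prev :: "(nat \<Rightarrow> real) \<Rightarrow> nat \<Rightarrow> real" where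
  "prev a t = (if t = 0 then 0 else a (t - 1))"

text \<open>What remains of the proximal gain of one half of the weighted square once the momentum
  cross term has taken its share \<open>\<tau> t / 2\<close>.\<close>

definition energy :: "nat \<Rightarrow> real" where
  "energy t = (1 - \<tau> t) / 2 * weighted_norm_sq (v t) (d t)"

text \<open>A real-valued objective along the iterates; it loses nothing because \<open>h\<close> is
  finite there, by \<open>h_finite\<close>.\<close>

definition F :: "nat \<Rightarrow> real" where
  "F t = f (x t) + real_of_ereal (h (x t))"

lemma prev_simps [simp]: "prev a 0 = 0" "prev a (Suc t) = a t"
  by (simp_all add: prev_def)

lemma tau_simps [simp]: "\<tau> 0 = \<theta>" "\<tau> (Suc t) = \<sigma> t"
  by (simp_all add: \<tau>_def)

lemma run_simps:
  "y 0 = x 0" "v 0 = vlow *\<^sub>R 1" "g t = gradient f (y t)" "d t = x (Suc t) - x t" "r t = v t * d t"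
  "s t = (\<alpha> * (norm (r t))\<^sup>2) *\<^sub>R 1 + \<beta> *\<^sub>R (r t * r t)"
  "v (Suc t) = vec_sqrt (v 0 * v 0 + (\<Sum>i\<le>t. s i))"
  "\<sigma> t = \<theta> * (1 - \<tau> t) * min_entry (vec_div (v t) (v (Suc t)))"
  "y (Suc t) = x (Suc t) + \<sigma> t *\<^sub>R d t"
  using run unfolding AEPG_def \<tau>_def by blast+

lemma x_Suc_Prox: "x (Suc t) \<in> Prox h (y t - vec_div (g t) (v t)) (v t)"
  using run unfolding AEPG_def by blast

lemma L_nonneg: "0 \<le> L"
proof -
  have "0 \<le> L * norm ((1 :: real ^ 'n) - 0)" using lipschitz norm_ge_zero order_trans by blast
  then show ?thesis by (simp add: zero_le_mult_iff)
qed

section \<open>Growth of the weights \<open>v\<close> and of their scalar majorant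
  \<open>V\<close>\<close>

lemma V_eq: "V t = sqrt (vlow\<^sup>2 + (\<alpha> + \<beta>) * (\<Sum>k<t. (norm (r k))\<^sup>2))"
  using vlow_pos by (cases t) (simp_all add: cal_R_def lessThan_Suc_atMost)

lemma v_nth: "v t $ i = sqrt (vlow\<^sup>2 + (\<Sum>k<t. \<alpha> * (norm (r k))\<^sup>2 + \<beta> * (r k $ i)\<^sup>2))"
proof (cases t)
  case 0
  then show ?thesis using vlow_pos by (simp add: run_simps(2))
next
  case (Suc k)
  show ?thesis
    unfolding Suc run_simps(7)
    by (simp add: vec_sqrt_def run_simps(2,6) lessThan_Suc_atMost power2_eq_square)
qed

lemma v_mono: "k \<le> t \<Longrightarrow> v k $ i \<le> v t $ i"
  unfolding v_nth using alpha_pos beta_nonneg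
  by (intro real_sqrt_le_mono add_left_mono sum_mono2) auto

lemma vlow_le_v: "vlow \<le> v t $ i"
  using v_mono[of 0 t i] by (simp add: run_simps(2))

lemma v_pos: "0 < v t $ i"
  using vlow_le_v vlow_pos less_le_trans by blast

lemma v_nonneg: "0 \<le> v t $ i"
  using v_pos less_imp_le by blast

lemma v_le_V: "v t $ i \<le> V t"
  unfolding v_nth V_eq sum_distrib_left
proof (intro real_sqrt_le_mono add_left_mono sum_mono)
  fix k
  have "(r k $ i)\<^sup>2 \<le> (norm (r k))\<^sup>2"
    using component_le_norm_cart[of "r k" i] by (metis abs_ge_zero power2_abs power_mono)
  then have "\<beta> * (r k $ i)\<^sup>2 \<le> \<beta> * (norm (r k))\<^sup>2" using beta_nonneg by (rule mult_left_mono)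
  then show "\<alpha> * (norm (r k))\<^sup>2 + \<beta> * (r k $ i)\<^sup>2 \<le> (\<alpha> + \<beta>) * (norm (r k))\<^sup>2"
    by (simp add: distrib_right)
qed

lemma V_mono: "k \<le> t \<Longrightarrow> V k \<le> V t"
  unfolding V_eq using alpha_pos beta_nonneg
  by (intro real_sqrt_le_mono add_left_mono mult_left_mono sum_mono2) auto

lemma vlow_le_V: "vlow \<le> V t"
  using V_mono[of 0 t] by simp

lemma V_pos: "0 < V t"
  using vlow_le_V vlow_pos less_le_trans by blast

lemma V_sq: "(V t)\<^sup>2 = vlow\<^sup>2 + (\<alpha> + \<beta>) * (\<Sum>k<t. (norm (r k))\<^sup>2)"
  unfolding V_eq using alpha_pos beta_nonneg
  by (intro real_sqrt_pow2) (auto intro!: add_nonneg_nonneg sum_nonneg mult_nonneg_nonneg)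

lemma weighted_nonneg: "0 \<le> weighted_norm_sq (v t) u"
  by (rule weighted_norm_sq_nonneg) (rule v_nonneg)

section \<open>Control of the momentum\<close>

lemma min_entry_ratio:
  shows "min_entry (vec_div (v t) (v (Suc t))) * v (Suc t) $ i \<le> v t $ i"
    and "0 \<le> min_entry (vec_div (v t) (v (Suc t)))"
    and "min_entry (vec_div (v t) (v (Suc t))) \<le> 1"
proof -
  let ?q = "vec_div (v t) (v (Suc t))"
  have le: "min_entry ?q \<le> v t $ j / v (Suc t) $ j" for j
    by (simp add: min_entry_def vec_div_def)
  show "min_entry ?q * v (Suc t) $ i \<le> v t $ i"
    using le[of i] v_pos[of "Suc t" i] by (simp add: pos_le_divide_eq)
  show "0 \<le> min_entry ?q"
    using v_nonneg by (simp add: min_entry_def vec_div_def)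
  have "v t $ i / v (Suc t) $ i \<le> 1"
    using v_pos[of "Suc t" i] v_mono[of t "Suc t" i] by simp
  then show "min_entry ?q \<le> 1" using le[of i] by linarith
qed

lemma tau_bounds: "0 \<le> \<tau> t \<and> \<tau> t \<le> \<theta>"
proof (induction t)
  case 0
  then show ?case using theta_nonneg by simp
next
  case (Suc t)
  then have "0 \<le> 1 - \<tau> t" "1 - \<tau> t \<le> 1" using theta_less_1 by auto
  moreover have "\<sigma> t = \<theta> * ((1 - \<tau> t) * min_entry (vec_div (v t) (v (Suc t))))"
    by (simp add: run_simps(8))
  ultimately show ?case
    using min_entry_ratio(2,3)[of t] theta_nonneg
    by (simp add: mult_le_one mult_left_le)
qed

lemma energy_ge: "(1 - \<theta>) / 2 * weighted_norm_sq (v t) (d t) \<le> energy t"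
  unfolding energy_def using tau_bounds[of t] weighted_nonneg by (intro mult_right_mono) auto

lemma energy_nonneg: "0 \<le> energy t"
  unfolding energy_def using tau_bounds[of t] theta_less_1 weighted_nonneg by simp

lemma norm_momentum_le: "norm (y t - x t) \<le> prev (\<lambda>k. norm (d k)) t"
proof (cases t)
  case (Suc k)
  have "\<bar>\<sigma> k\<bar> \<le> 1" using tau_bounds[of "Suc k"] theta_less_1 by simp
  then show ?thesis by (simp add: Suc run_simps(9) mult_left_le_one_le)
qed (simp add: run_simps(1))

text \<open>Young's inequality splits the product of the current and the previous step. The factor
  \<open>min_entry\<close> inside \<sigma> pays for changing the weights of the previous step from
  \<open>v (Suc k)\<close> to \<open>v k\<close>, which leaves \<theta> times its energy.\<close>

lemma momentum_inner_le:
  "(v t * d t) \<bullet> (y t - x t) \<le> \<tau> t / 2 * weighted_norm_sq (v t) (d t) + \<theta> * prev energy t"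
proof (cases t)
  case 0
  then show ?thesis using theta_nonneg weighted_nonneg[of 0] by (simp add: run_simps(1))
next
  case (Suc k)
  have "\<sigma> k * v (Suc k) $ i \<le> \<theta> * (1 - \<tau> k) * v k $ i" for i
    unfolding run_simps(8)[of k] mult.assoc
    using min_entry_ratio(1)[of k i] tau_bounds[of k] theta_nonneg theta_less_1
    by (intro mult_left_mono) auto
  then have "\<sigma> k * weighted_norm_sq (v (Suc k)) (d k) \<le> \<theta> * (1 - \<tau> k) * weighted_norm_sq (v k) (d k)"
    unfolding weighted_norm_sq_def sum_distrib_left mult.left_commute[of _ "(d k $ _)\<^sup>2"]
    by (intro sum_mono mult_left_mono) auto
  moreover have "\<sigma> k * (2 * ((v (Suc k) * d (Suc k)) \<bullet> d k))
      \<le> \<sigma> k * (weighted_norm_sq (v (Suc k)) (d (Suc k)) + weighted_norm_sq (v (Suc k)) (d k))"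
    using tau_bounds[of "Suc k"] by (intro mult_left_mono inner_weighted_young v_nonneg) simp
  ultimately show ?thesis
    by (simp add: Suc run_simps(9) energy_def field_simps)
qed

section \<open>Descent along one step and the potential function\<close>

lemma h_finite: "\<bar>h (x t)\<bar> \<noteq> \<infinity>"
proof (cases t)
  case 0
  have "h (x 0) \<noteq> -\<infinity>" using proper by (simp add: proper_def)
  moreover have "h (x 0) \<noteq> \<infinity>" using run by (auto simp: AEPG_def edom_def objective_def)
  ultimately show ?thesis using 0 by auto
next
  case (Suc k)
  show ?thesis unfolding Suc using x_Suc_Prox proper by (rule Prox_finite)
qed

lemma F_ge: "m \<le> F t"
  using objective_ge[of "x t"] h_finite[of t]
  by (cases "h (x t)") (auto simp: objective_def F_def)

text \<open>The division by \<open>v t\<close> in the centre of the proximal step cancels against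
  the metric, as all entries are positive.\<close>

lemma metric_prox_residual: "v t * (u - (y t - vec_div (g t) (v t))) = v t * (u - y t) + g t"
  using v_pos[of t] by (auto simp: vec_eq_iff vec_div_def algebra_simps less_imp_neq[symmetric])

lemma descent_step:
  "F (Suc t) + energy t \<le> F t + \<theta> * prev energy t
     + L * (norm (d t) + prev (\<lambda>k. norm (d k)) t) * norm (d t)"
proof -
  let ?a = "y t - vec_div (g t) (v t)" and ?W = "weighted_norm_sq (v t) (d t)"
  obtain c c' where c: "h (x t) = ereal c" "h (x (Suc t)) = ereal c'"
    using h_finite[of t] h_finite[of "Suc t"] by (cases "h (x t)"; cases "h (x (Suc t))") auto
  have "c' + 1/2 * weighted_norm_sq (v t) (x (Suc t) - ?a) \<le> c + 1/2 * weighted_norm_sq (v t) (x t - ?a)"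
    using Prox_le[OF x_Suc_Prox, of t "x t"] c by simp
  \<comment> \<open>Expanding around \<open>x t\<close> cancels the common term and leaves half the
    weighted square of \<open>d t\<close> as gain.\<close>
  then have "c' + (v t * (x t - ?a)) \<bullet> d t + 1/2 * ?W \<le> c"
    unfolding weighted_norm_sq_diff[of "v t" "x (Suc t)" ?a "x t"] run_simps(4)[symmetric] by (simp add: field_simps)
  moreover have "(v t * (x t - ?a)) \<bullet> d t = g t \<bullet> d t - (v t * d t) \<bullet> (y t - x t)"
    unfolding metric_prox_residual inner_vec_def sum_subtractf[symmetric]
    by (intro sum.cong) (auto simp: algebra_simps)
  ultimately have nonsmooth: "c' + g t \<bullet> d t + 1/2 * ?W - (v t * d t) \<bullet> (y t - x t) \<le> c" by simp
  obtain z where z: "f (x (Suc t)) - f (x t) = gradient f z \<bullet> d t" "norm (z - x t) \<le> norm (d t)"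
    using GDERIV_mean_value[of f "gradient f" "x (Suc t)" "x t"] gderiv run_simps(4)[of t] by metis
  \<comment> \<open>The step uses the gradient at \<open>y t\<close>, the mean value theorem the one
    at \<open>z\<close>; their distance is at most the sum of the current and the previous step
    lengths.\<close>
  have "norm (z - y t) \<le> norm (z - x t) + norm (y t - x t)"
    using norm_triangle_ineq4[of "z - x t" "y t - x t"] by simp
  then have "norm (z - y t) \<le> norm (d t) + prev (\<lambda>k. norm (d k)) t"
    using z(2) norm_momentum_le[of t] by linarith
  then have "norm (gradient f z - g t) \<le> L * (norm (d t) + prev (\<lambda>k. norm (d k)) t)"
    unfolding run_simps(3) using lipschitz L_nonneg by (meson mult_left_mono order_trans)
  then have "(gradient f z - g t) \<bullet> d t \<le> L * (norm (d t) + prev (\<lambda>k. norm (d k)) t) * norm (d t)"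
    by (meson mult_right_mono norm_cauchy_schwarz norm_ge_zero order_trans)
  then have "f (x (Suc t)) - f (x t) \<le> g t \<bullet> d t + L * (norm (d t) + prev (\<lambda>k. norm (d k)) t) * norm (d t)"
    using z(1) by (simp add: inner_diff_left)
  moreover have "energy t = 1/2 * ?W - \<tau> t / 2 * ?W" by (simp add: energy_def field_simps)
  moreover have "F t = f (x t) + c" "F (Suc t) = f (x (Suc t)) + c'" using c by (simp_all add: F_def)
  ultimately show ?thesis
    using nonsmooth momentum_inner_le[of t] by linarith
qed

text \<open>The two added terms are the delayed quantities of \<open>descent_step\<close>, the
  second after Young's inequality; including them makes the delay telescope.\<close>

definition \<Psi> :: "nat \<Rightarrow> real" where
  "\<Psi> t = F t + \<theta> * prev energy t + L / 2 * prev (\<lambda>k. (norm (d k))\<^sup>2) t"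

lemma Psi_ge: "m \<le> \<Psi> t"
proof -
  have "0 \<le> \<theta> * prev energy t" "0 \<le> L / 2 * prev (\<lambda>k. (norm (d k))\<^sup>2) t"
    using theta_nonneg L_nonneg energy_nonneg by (simp_all add: prev_def)
  then show ?thesis using F_ge[of t] by (simp add: \<Psi>_def)
qed

lemma Psi_step: "\<Psi> (Suc t) + (1 - \<theta>) * energy t \<le> \<Psi> t + 2 * L * (norm (d t))\<^sup>2"
proof -
  let ?p = "prev (\<lambda>k. norm (d k)) t"
  have "0 \<le> L * (norm (d t) - ?p)\<^sup>2" using L_nonneg by simp
  \<comment> \<open>Young's inequality on the mixed product. The next potential adds another
    \<open>L / 2\<close>, giving the total coefficient \<open>2 * L\<close>.\<close>
  then have "L * (norm (d t) + ?p) * norm (d t) \<le> 3 * L / 2 * (norm (d t))\<^sup>2 + L / 2 * ?p\<^sup>2"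
    by (simp add: power2_eq_square algebra_simps)
  moreover have "?p\<^sup>2 = prev (\<lambda>k. (norm (d k))\<^sup>2) t" by (simp add: prev_def)
  ultimately show ?thesis
    using descent_step[of t] by (simp add: \<Psi>_def algebra_simps)
qed

text \<open>The energy is at least \<open>(1 - \<theta>) / 2 * W\<close> times the squared step.
  Half of the available decrease then absorbs the error \<open>2 * L\<close> times that square
  exactly when \<open>W * (1 - \<theta>)\<^sup>2\<close> reaches \<open>8 * L\<close>.\<close>

lemma Psi_step_large:
  assumes W: "W * (1 - \<theta>)\<^sup>2 \<ge> 8 * L" "W > 0" "\<And>i. W \<le> v t $ i"
  shows "\<Psi> (Suc t) + (1 - \<theta>) / 2 * energy t \<le> \<Psi> t"
proof -
  have "8 * L * (norm (d t))\<^sup>2 \<le> (1 - \<theta>)\<^sup>2 * (W * (norm (d t))\<^sup>2)"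
    using mult_right_mono[OF W(1), of "(norm (d t))\<^sup>2"] by (simp add: mult_ac)
  also have "\<dots> \<le> (1 - \<theta>)\<^sup>2 * weighted_norm_sq (v t) (d t)"
    using weighted_norm_sq_ge[OF W(3)] by (intro mult_left_mono) auto
  also have "\<dots> = 2 * (1 - \<theta>) * ((1 - \<theta>) / 2 * weighted_norm_sq (v t) (d t))"
    by (simp add: power2_eq_square)
  also have "\<dots> \<le> 2 * (1 - \<theta>) * energy t"
    using energy_ge theta_less_1 by (intro mult_left_mono) auto
  finally show ?thesis using Psi_step[of t] by (simp add: field_simps)
qed

section \<open>Boundedness of \<open>V\<close>\<close>

lemma V_step: "V (Suc t) - V t \<le> 2 * (\<alpha> + \<beta>) / (1 - \<theta>) * energy t"
proof -
  let ?W = "weighted_norm_sq (v t) (d t)"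
  \<comment> \<open>The difference of squares carries one factor \<open>V t\<close> from bounding
    the weights; cancelling it makes the increment of \<open>V\<close> linear in the energy.\<close>
  have "(V (Suc t) - V t) * V t \<le> (V (Suc t) - V t) * (V (Suc t) + V t)"
    using V_mono[of t "Suc t"] V_pos[of "Suc t"] by (intro mult_left_mono) auto
  also have "\<dots> = (V (Suc t))\<^sup>2 - (V t)\<^sup>2" by (simp add: power2_eq_square algebra_simps)
  also have "\<dots> = (\<alpha> + \<beta>) * (norm (v t * d t))\<^sup>2"
    unfolding V_sq by (simp add: algebra_simps run_simps(5))
  also have "\<dots> \<le> (\<alpha> + \<beta>) * (V t * ?W)"
    using alpha_pos beta_nonneg
    by (intro mult_left_mono norm_mult_sq_le_weighted v_nonneg v_le_V) auto
  finally have "(V (Suc t) - V t) * V t \<le> ((\<alpha> + \<beta>) * ?W) * V t" by (simp add: mult_ac)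
  then have "V (Suc t) - V t \<le> (\<alpha> + \<beta>) * ?W" using V_pos by (simp only: mult_le_cancel_right_pos)
  also have "\<dots> = 2 * (\<alpha> + \<beta>) / (1 - \<theta>) * ((1 - \<theta>) / 2 * ?W)"
    using theta_less_1 by simp
  also have "\<dots> \<le> 2 * (\<alpha> + \<beta>) / (1 - \<theta>) * energy t"
    using energy_ge theta_less_1 alpha_pos beta_nonneg by (intro mult_left_mono) auto
  finally show ?thesis .
qed

lemma V_bounded_if_large:
  assumes W: "W * (1 - \<theta>)\<^sup>2 \<ge> 8 * L" "W > 0" "\<And>i. W \<le> v t0 $ i"
  shows "\<exists>B. \<forall>t. V t \<le> B"
proof -
  \<comment> \<open>Chosen so that \<open>c\<close> times the decrease in
    \<open>Psi_step_large\<close> equals the bound in \<open>V_step\<close>; hence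
    \<open>V + c * \<Psi>\<close> does not increase from \<open>t0\<close> on.\<close>
  define c where "c = 4 * (\<alpha> + \<beta>) / (1 - \<theta>)\<^sup>2"
  have c: "0 \<le> c" using alpha_pos beta_nonneg by (simp add: c_def)
  have decr: "V (Suc t) + c * \<Psi> (Suc t) \<le> V t + c * \<Psi> t" if "t0 \<le> t" for t
  proof -
    have "\<And>i. W \<le> v t $ i" using W(3) v_mono[OF that] order_trans by blast
    then have "c * (\<Psi> (Suc t) + (1 - \<theta>) / 2 * energy t) \<le> c * \<Psi> t"
      using Psi_step_large[OF W(1,2)] c by (intro mult_left_mono) auto
    moreover have "c * ((1 - \<theta>) / 2 * energy t) = 2 * (\<alpha> + \<beta>) / (1 - \<theta>) * energy t"
      using theta_less_1 by (simp add: c_def power2_eq_square divide_simps) (simp add: algebra_simps)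
    ultimately show ?thesis using V_step[of t] unfolding distrib_left by linarith
  qed
  have "V t + c * \<Psi> t \<le> V t0 + c * \<Psi> t0" if "t0 \<le> t" for t
    using that
  proof (induction t rule: dec_induct)
    case (step t)
    then show ?case using decr order_trans by blast
  qed simp
  moreover have "c * m \<le> c * \<Psi> t" for t using Psi_ge c by (intro mult_left_mono)
  ultimately have "V t \<le> V t0 + c * \<Psi> t0 - c * m" if "t0 \<le> t" for t
    using that by (meson add_left_mono le_diff_eq order_trans)
  \<comment> \<open>Indices before \<open>t0\<close> are covered by monotonicity of
    \<open>V\<close>.\<close>
  then have "V t \<le> V t0 + c * \<Psi> t0 - c * m" for t
    using V_mono[of t "max t0 t"] by (meson max.cobounded1 max.cobounded2 order_trans)
  then show ?thesis by blast
qed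

lemma V_bounded: "\<exists>B. \<forall>t. V t \<le> B"
proof -
  \<comment> \<open>The summand 1 keeps the threshold positive when \<open>L = 0\<close>.\<close>
  define W where "W = 8 * L / (1 - \<theta>)\<^sup>2 + 1"
  have W: "W * (1 - \<theta>)\<^sup>2 \<ge> 8 * L" "W > 0"
    using theta_less_1 L_nonneg by (auto simp: W_def distrib_right intro!: add_nonneg_pos)
  show ?thesis
  \<comment> \<open>Either the accumulated squares lift every entry of \<open>v\<close> above
    \<open>W\<close>, through the term with \<alpha> that all entries share, or they stay bounded
    and bound \<open>V\<close> directly.\<close>
  proof (cases "\<exists>t0. W\<^sup>2 \<le> \<alpha> * (\<Sum>k<t0. (norm (r k))\<^sup>2)")
    case True
    then obtain t0 where t0: "W\<^sup>2 \<le> \<alpha> * (\<Sum>k<t0. (norm (r k))\<^sup>2)" by blast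
    have "W \<le> v t0 $ i" for i
      unfolding v_nth
    proof (rule real_le_rsqrt)
      have "0 \<le> (\<Sum>k<t0. \<beta> * (r k $ i)\<^sup>2)" using beta_nonneg by (intro sum_nonneg) auto
      then show "W\<^sup>2 \<le> vlow\<^sup>2 + (\<Sum>k<t0. \<alpha> * (norm (r k))\<^sup>2 + \<beta> * (r k $ i)\<^sup>2)"
        using t0 by (simp add: sum.distrib sum_distrib_left add_increasing)
    qed
    then show ?thesis by (rule V_bounded_if_large[OF W])
  next
    case False
    then have "(\<Sum>k<t. (norm (r k))\<^sup>2) \<le> W\<^sup>2 / \<alpha>" for t
      using alpha_pos by (simp add: pos_le_divide_eq not_le less_imp_le mult.commute)
    then have "V t \<le> sqrt (vlow\<^sup>2 + (\<alpha> + \<beta>) * (W\<^sup>2 / \<alpha>))" for t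
      unfolding V_eq using alpha_pos beta_nonneg
      by (intro real_sqrt_le_mono add_left_mono mult_left_mono) auto
    then show ?thesis by blast
  qed
qed

section \<open>Summability of the steps and the stationarity measure\<close>

lemma sum_norm_d_sq_le:
  assumes "V t \<le> B"
  shows "(\<Sum>k<t. (norm (d k))\<^sup>2) \<le> 1 / \<alpha> * ((B / vlow)\<^sup>2 - 1)"
proof -
  have "vlow\<^sup>2 * (\<Sum>k<t. (norm (d k))\<^sup>2) \<le> (\<Sum>k<t. (norm (r k))\<^sup>2)"
    unfolding sum_distrib_left run_simps(5) using vlow_pos vlow_le_v
    by (intro sum_mono norm_mult_sq_ge) auto
  then have "\<alpha> * (vlow\<^sup>2 * (\<Sum>k<t. (norm (d k))\<^sup>2)) \<le> \<alpha> * (\<Sum>k<t. (norm (r k))\<^sup>2)"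
    using alpha_pos by simp
  also have "\<dots> \<le> (\<alpha> + \<beta>) * (\<Sum>k<t. (norm (r k))\<^sup>2)"
    using beta_nonneg by (intro mult_right_mono sum_nonneg) auto
  also have "\<dots> = (V t)\<^sup>2 - vlow\<^sup>2" by (simp add: V_sq)
  also have "\<dots> \<le> B\<^sup>2 - vlow\<^sup>2" using assms V_pos[of t] by (simp add: power_mono)
  finally show ?thesis
    using vlow_pos alpha_pos by (simp add: field_simps)
qed

text \<open>The infimum is at most its value at the subgradient supplied by the proximal step. What
  is left is a gradient difference, costing \<open>L\<close>, and a weighted displacement, costing
  \<open>B\<close>.\<close>

lemma stationarity_le:
  assumes "V t \<le> B"
  shows "stationarity f h (x (Suc t)) \<le> ereal ((L + B) * (norm (d t) + prev (\<lambda>k. norm (d k)) t))"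
proof -
  let ?\<xi> = "- (v t * (x (Suc t) - y t) + g t)"
  have "?\<xi> \<in> limiting_subdiff h (x (Suc t))"
    using Prox_subgradient[OF x_Suc_Prox proper] frechet_subset_limiting
    unfolding metric_prox_residual by blast
  then have "stationarity f h (x (Suc t)) \<le> ereal (norm (gradient f (x (Suc t)) + ?\<xi>))"
    unfolding stationarity_def by (rule INF_lower)
  also have "norm (gradient f (x (Suc t)) + ?\<xi>)
      \<le> norm (gradient f (x (Suc t)) - g t) + norm (v t * (x (Suc t) - y t))"
    using norm_triangle_ineq4[of "gradient f (x (Suc t)) - g t" "v t * (x (Suc t) - y t)"]
    by (simp only: diff_conv_add_uminus minus_add_distrib add_ac)
  also have "\<dots> \<le> L * norm (x (Suc t) - y t) + B * norm (x (Suc t) - y t)"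
    unfolding run_simps(3) using v_le_V[of t] assms
    by (intro add_mono lipschitz norm_mult_le v_nonneg) (meson order_trans)
  also have "\<dots> = (L + B) * norm (x (Suc t) - y t)" by (simp add: distrib_right)
  also have "\<dots> \<le> (L + B) * (norm (d t) + prev (\<lambda>k. norm (d k)) t)"
  proof (rule mult_left_mono)
    have "norm (x (Suc t) - y t) \<le> norm (d t) + norm (y t - x t)"
      using norm_triangle_ineq4[of "d t" "y t - x t"] by (simp add: run_simps(4))
    then show "norm (x (Suc t) - y t) \<le> norm (d t) + prev (\<lambda>k. norm (d k)) t"
      using norm_momentum_le[of t] by linarith
    show "0 \<le> L + B" using L_nonneg assms V_pos[of t] by simp
  qed
  finally show ?thesis by simp
qed

lemma sum_stationarity_le:
  assumes "\<And>t. V t \<le> B"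
  defines "X \<equiv> 1 / \<alpha> * ((B / vlow)\<^sup>2 - 1)"
  shows "(\<Sum>t<n. stationarity f h (x (Suc t))) \<le> ereal (2 * (L + B) * sqrt X * sqrt (real n))"
proof -
  have "(\<Sum>t<n. stationarity f h (x (Suc t)))
      \<le> (\<Sum>t<n. ereal ((L + B) * (norm (d t) + prev (\<lambda>k. norm (d k)) t)))"
    using assms(1) by (intro sum_mono stationarity_le)
  also have "\<dots> = ereal ((L + B) * ((\<Sum>t<n. norm (d t)) + (\<Sum>t<n. prev (\<lambda>k. norm (d k)) t)))"
    by (simp add: sum_distrib_left[symmetric] sum.distrib)
  also have "\<dots> \<le> ereal ((L + B) * (2 * (sqrt X * sqrt (real n))))"
  proof (unfold ereal_less_eq, rule mult_left_mono)
    \<comment> \<open>The delayed sum starts with 0 and omits the last step; this is the origin of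
      the factor 2.\<close>
    have shift: "(\<Sum>t<n. prev (\<lambda>k. norm (d k)) t) \<le> (\<Sum>t<n. norm (d t))"
    proof (cases n)
      case (Suc k)
      have "(\<Sum>t<Suc k. prev (\<lambda>k. norm (d k)) t) = (\<Sum>t<k. norm (d t))"
        unfolding sum.lessThan_Suc_shift by simp
      then show ?thesis by (simp add: Suc)
    qed simp
    have "(\<Sum>t<n. norm (d t))\<^sup>2 \<le> (\<Sum>t<n. (norm (d t))\<^sup>2) * real n"
      using Cauchy_Schwarz_ineq_sum[of "\<lambda>t. norm (d t)" "\<lambda>_. 1" "{..<n}"] by simp
    also have "\<dots> \<le> X * real n"
      unfolding X_def using sum_norm_d_sq_le[OF assms(1)] by (intro mult_right_mono) auto
    finally have "(\<Sum>t<n. norm (d t)) \<le> sqrt X * sqrt (real n)"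
      unfolding real_sqrt_mult[symmetric] by (rule real_le_rsqrt)
    then show "(\<Sum>t<n. norm (d t)) + (\<Sum>t<n. prev (\<lambda>k. norm (d k)) t) \<le> 2 * (sqrt X * sqrt (real n))"
      using shift by linarith
    show "0 \<le> L + B" using L_nonneg assms(1)[of 0] V_pos[of 0] by linarith
  qed
  finally show ?thesis by (simp only: mult_ac)
qed

end

section \<open>Rates for the averaged objective\<close>

theorem theorem3p5:
  fixes f :: "nat \<Rightarrow> real ^ 'n \<Rightarrow> real"
    and h :: "real ^ 'n \<Rightarrow> ereal"
    and N :: nat
    and L xbar vlow \<alpha> \<beta> \<theta> :: real
    and x y g d r s v :: "nat \<Rightarrow> real ^ 'n"
    and \<sigma> :: "nat \<Rightarrow> real"
  assumes "N \<ge> 1"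
    and "\<forall>j\<in>{1..N}. \<forall>u. f j differentiable (at u)"
    and "proper h" and "lower_semicontinuous h"
    and "\<forall>a w. (\<forall>i. w $ i > 0) \<longrightarrow> Prox h a w \<noteq> {}"
    and "xbar > 0"
    and "\<forall>u \<in> edom (objective (average N f) h). norm u \<le> xbar"
    and "(INF u. objective (average N f) h u) > -\<infinity>"
    and "\<forall>j\<in>{1..N}. \<forall>u w. norm (gradient (f j) u - gradient (f j) w) \<le> L * norm (u - w)"
    and "vlow > 0" and "\<alpha> > 0" and "\<beta> \<ge> 0" and "0 \<le> \<theta>" and "\<theta> < 1"
    and "AEPG (average N f) h vlow \<alpha> \<beta> \<theta> x y g d r s v \<sigma>"
  shows "\<exists>vbar>0.
    (\<forall>t. cal_V vlow \<alpha> \<beta> r t \<le> vbar) \<and>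
    (\<forall>T. (\<Sum>t=0..T. (norm (x (Suc t) - x t))\<^sup>2) \<le> 1 / \<alpha> * ((vbar / vlow)\<^sup>2 - 1)) \<and>
    (\<exists>K>0. \<forall>T\<ge>1. (\<Sum>t=0..T. stationarity (average N f) h (x (Suc t))) / ereal (real (T + 1))
                    \<le> ereal (K / sqrt (real T))) \<and>
    (\<exists>C>0. \<forall>\<epsilon>>0. \<forall>T\<ge>1. real T \<ge> C / \<epsilon>\<^sup>2 \<longrightarrow>
       (\<exists>t\<in>{1..T}. stationarity (average N f) h (x t) \<le> ereal \<epsilon>))"
proof -
  have diff: "\<And>j u. j \<in> {1..N} \<Longrightarrow> f j differentiable (at u)" using assms(2) by blast
  \<comment> \<open>A real number strictly between minus infinity and the infimum, so that the lower
    bound is available in real arithmetic.\<close>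
  obtain m where m: "ereal m < (INF u. objective (average N f) h u)"
    using ereal_dense2[OF assms(8)] by blast
  interpret aepg_run "average N f" h L m vlow \<alpha> \<beta> \<theta> x y g d r s v \<sigma>
  proof
    fix u w
    show "GDERIV (average N f) u :> gradient (average N f) u"
      using GDERIV_average[of N f u "\<lambda>j. gradient (f j) u"] GDERIV_gradient diff gradient_eqI by metis
    show "norm (gradient (average N f) u - gradient (average N f) w) \<le> L * norm (u - w)"
      using assms(1,9) by (intro gradient_average_lipschitz diff) auto
    show "ereal m \<le> objective (average N f) h u"
      using m by (meson INF_lower UNIV_I less_imp_le order_trans)
  qed (use assms in auto)
  obtain B where B: "\<And>t. V t \<le> B" using V_bounded by blast
  have "0 < B" using B[of 0] V_pos[of 0] by linarith
  \<comment> \<open>The maximum with 1 keeps the constant positive even if the square root vanishes,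
    as for \<open>B = vlow\<close>.\<close>
  define K where "K = max 1 (2 * (L + B) * sqrt (1 / \<alpha> * ((B / vlow)\<^sup>2 - 1)))"
  have K: "0 < K" by (simp add: K_def)
  have sums: "(\<Sum>t<n. stationarity (average N f) h (x (Suc t))) \<le> ereal (K * sqrt (real n))" for n
    using sum_stationarity_le[OF B, of n]
    by (rule order_trans) (simp add: K_def mult_right_mono)
  have "(\<Sum>t=0..T. stationarity (average N f) h (x (Suc t))) / ereal (real (T + 1)) \<le> ereal (K / sqrt (real T))"
    if "1 \<le> T" for T
  proof -
    have "(\<Sum>t=0..T. stationarity (average N f) h (x (Suc t))) / ereal (real (T + 1))
        \<le> ereal (K * sqrt (real (T + 1))) / ereal (real (T + 1))"
      using sums[of "Suc T"]
      by (intro ereal_divide_right_mono) (simp_all add: atLeast0AtMost lessThan_Suc_atMost)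
    also have "\<dots> = ereal (K / sqrt (real (T + 1)))"
      using real_div_sqrt[of "real (T + 1)"] by (simp add: field_simps)
    also have "\<dots> \<le> ereal (K / sqrt (real T))"
      using that K by (simp add: frac_le)
    finally show ?thesis .
  qed
  then have rate: "\<exists>K>0. \<forall>T\<ge>1. (\<Sum>t=0..T. stationarity (average N f) h (x (Suc t))) / ereal (real (T + 1))
      \<le> ereal (K / sqrt (real T))"
    using K by blast
  \<comment> \<open>The sum over \<open>t < T\<close> runs through the iterates 1 to
    \<open>T\<close>. If all measures exceeded \<epsilon>, then
    \<open>real T * \<epsilon>\<^sup>2\<close> would be at most \<open>K\<^sup>2\<close>; the factor
    2 in the constant makes this contradictory.\<close>
  have "\<exists>t\<in>{1..T}. stationarity (average N f) h (x t) \<le> ereal \<epsilon>"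
    if "0 < \<epsilon>" "1 \<le> T" "(2 * K\<^sup>2) / \<epsilon>\<^sup>2 \<le> real T" for \<epsilon> T
  proof (rule ccontr)
    assume "\<not> ?thesis"
    then have large: "ereal \<epsilon> \<le> stationarity (average N f) h (x (Suc t))" if "t < T" for t
      using that by (auto simp: not_le less_imp_le)
    have "ereal (real T * \<epsilon>) = (\<Sum>t<T. ereal \<epsilon>)" by simp
    also have "\<dots> \<le> (\<Sum>t<T. stationarity (average N f) h (x (Suc t)))"
      using large by (intro sum_mono) auto
    also have "\<dots> \<le> ereal (K * sqrt (real T))" by (rule sums)
    finally have "real T * \<epsilon> \<le> K * sqrt (real T)" by simp
    then have "(real T * \<epsilon>)\<^sup>2 \<le> (K * sqrt (real T))\<^sup>2"
      using that by (intro power_mono) auto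
    then have "real T * (real T * \<epsilon>\<^sup>2) \<le> real T * K\<^sup>2"
      by (simp add: power_mult_distrib power2_eq_square mult_ac)
    then have "real T * \<epsilon>\<^sup>2 \<le> K\<^sup>2" using that by simp
    moreover have "2 * K\<^sup>2 \<le> real T * \<epsilon>\<^sup>2" using that by (simp add: pos_divide_le_eq)
    moreover have "0 < K\<^sup>2" using K by simp
    ultimately show False by linarith
  qed
  then have complexity: "\<exists>C>0. \<forall>\<epsilon>>0. \<forall>T\<ge>1. real T \<ge> C / \<epsilon>\<^sup>2 \<longrightarrow>
      (\<exists>t\<in>{1..T}. stationarity (average N f) h (x t) \<le> ereal \<epsilon>)"
    using K by (intro exI[of _ "2 * K\<^sup>2"]) auto
  have displacement: "(\<Sum>t=0..T. (norm (x (Suc t) - x t))\<^sup>2) \<le> 1 / \<alpha> * ((B / vlow)\<^sup>2 - 1)" for T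
    using sum_norm_d_sq_le[OF B, of "Suc T"]
    by (simp add: run_simps(4) atLeast0AtMost lessThan_Suc_atMost)
  show ?thesis
    by (rule exI[of _ B], intro conjI allI) (fact \<open>0 < B\<close> B displacement rate complexity)+
qed

end
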